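(* Consider a distributed storage system (DSS) that uses an $[n,k]$ Reed-Solomon (RS) code $\mathscr{C}$ over $\mathbb{F}_q$ to store $f$ messages over $n$ noncolluding databases using systematic Lagrange encoding. Let $\mu\in\{f,f+1,\ldots,\mu_g(f)\}$ be the number of candidate polynomial function evaluations of degree at most $g$, including the $f$ independent messages. Let $\tilde k=\min\{g(k-1)+1,n\}$ and $$\hat n=\begin{cases}n&\text{if }\lfloor n/\tilde k\rfloor=1\text{ and }n-\lfloor n/\tilde k\rfloor\tilde k<k,\\k+(\lfloor n/\tilde k\rfloor-1)\tilde k&\text{if }\lfloor n/\tilde k\rfloor>1\text{ and }n-\lfloor n/\tilde k\rfloor\tilde k<k,\\k+\lfloor n/\tilde k\rfloor\tilde k&\text{if }\lfloor n/\tilde k\rfloor\ge1\text{ and }n-\lfloor n/\tilde k\rfloor\tilde k\ge k.\end{cases}$$ Then the private polynomial computation (PPC) rate $\mathsf{R}^{\mathrm{S}}_{\mathrm{PPC},\infty}=c\,\mathsf{H}_{\min}$ with $$c=\begin{cases}\frac1n\max\{n-g(k-1)-1,0\}&\text{if }\lfloor\frac n{\tilde k}\rfloor=1\text{ and }n-\lfloor\frac n{\tilde k}\rfloor\tilde k<k,\\[1ex]\frac1{\hat n}\left(\left\lfloor\frac{n}{g(k-1)+1}\right\rfloor k-k\right)&\text{if }\lfloor\frac n{\tilde k}\rfloor>1\text{ and }n-\left\lfloor\frac{n}{g(k-1)+1}\right\rfloor(g(k-1)+1)<k,\\[1ex]\frac1{\hat n}\left\lfloor\frac{n}{g(k-1)+1}\right\rfloor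 k&\text{if }\lfloor\frac n{\tilde k}\rfloor\ge1\text{ and }n-\left\lfloor\frac{n}{g(k-1)+1}\right\rfloor(g(k-1)+1)\ge k\end{cases}$$ (cases read in order) is asymptotically achievable for $f\to\infty$; that is, with $n,k,g,q$ fixed and for any choice of candidate sets for each $f$, there are PPC protocols with rates $\mathsf{R}_f=(c+\varepsilon_f)\mathsf{H}_{\min}$, where $\varepsilon_f\to0$ as $f\to\infty$ (and $\mathsf{H}_{\min}$ is that of the candidate set for $f$).
   Context: Notation: $[a]=\{1,\ldots,a\}$; entropies $H$ are in $q$-ary units. $\mathsf{M}_g(f)=\binom{g+f}{g}-1$ is the number of monomials in $f$ variables of degree between $1$ and $g$, and $\mu_g(f)=\frac{q^{\mathsf{M}_g(f)}-1}{q-1}$ is the number of polynomials that are linear combinations over $\mathbb{F}_q$ of these monomials with nonzero coefficient vectors, counted up to scalar multiples. Systematic Lagrange encoding: let $\alpha_1,\ldots,\alpha_n\in\mathbb{F}_q$ be distinct ($q\ge n\ge k$). The $[n,k]$ RS code is $\{(\phi(\alpha_1),\ldots,\phi(\alpha_n)):\phi\in\mathbb{F}_q[z],\deg\phi<k\}$; a vector $(w_1,\ldots,w_k)\in\mathbb{F}_q^k$ is encoded as $(\ell(\alpha_1),\ldots,\ell(\alpha_n))$, where $\ell$ is the unique polynomial of degree at most $k-1$ with $\ell(\alpha_i)=w_i$ for all $i\in[k]$ (so the first $k$ code symbols are the information symbols). Storage: there are $f$ independent messages $\mathbf{W}^{(1)},\ldots,\mathbf{W}^{(f)}$; each $\mathbf{W}^{(m)}$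 is a random $\beta\times k$ matrix with entries i.i.d. uniform over $\mathbb{F}_q$, also written as a vector $(W^{(m)}_1,\ldots,W^{(m)}_{\mathsf{L}})$ with $\mathsf{L}=\beta k$. Each row $\mathbf{W}^{(m)}_i$ is encoded into $(C^{(m)}_{i,1},\ldots,C^{(m)}_{i,n})$. Database $j\in[n]$ stores $\mathbf{C}_j=(C^{(m)}_{i,j})_{i\in[\beta],m\in[f]}$. The parameter $\beta$ may be chosen by the scheme. Candidate functions: $\phi^{(1)},\ldots,\phi^{(\mu)}$ are polynomials in $f$ variables over $\mathbb{F}_q$ that are linear combinations of monomials of degree between $1$ and $g$ with pairwise nonproportional nonzero coefficient vectors, and the coordinate polynomials $z_1,\ldots,z_f$ (the $f$ messages) are among them. Put $X^{(v)}_l=\phi^{(v)}(W^{(1)}_l,\ldots,W^{(f)}_l)$ for $l\in[\mathsf{L}]$, $\mathbf{X}^{(v)}=(X^{(v)}_1,\ldots,X^{(v)}_{\mathsf{L}})$, $\mathbf{X}^{[\mu]}=(\mathbf{X}^{(1)},\ldots,\mathbf{X}^{(\mu)})$, and $\mathsf{H}_{\min}=\min_{v\in[\mu]}H(X^{(v)}_l)$ (independent of $l$). PPC protocol: for each desired index $v\in[\mu]$ the user sends a (random) query $Q^{(v)}_j$, generated independently of the messages, to each database $j\in[n]$ (possibly an empty query, in which case nothing is downloaded from it). Database $j$ returns an answer $A^{(v)}_j$ (a string of symbols of $\mathbb{F}_q$) that is a deterministic function of $Q^{(v)}_j$ and $\mathbf{C}_j$. The protocol must satisfy, for all $v\ne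 v'$ in $[\mu]$ and $j\in[n]$: (privacy) $(Q^{(v)}_j,A^{(v)}_j,\mathbf{X}^{[\mu]})$ and $(Q^{(v')}_j,A^{(v')}_j,\mathbf{X}^{[\mu]})$ are identically distributed; (recovery) $H(\mathbf{X}^{(v)}\mid A^{(v)}_1,\ldots,A^{(v)}_n,Q^{(v)}_1,\ldots,Q^{(v)}_n)=0$. Rate: the rate of a protocol is $\mathsf{L}\mathsf{H}_{\min}/\mathsf{D}$, where $\mathsf{D}$ is the total download cost, i.e. the total number of symbols of $\mathbb{F}_q$ downloaded from all databases. A rate is achievable if there is a PPC protocol attaining it for some $\beta$. *)

theory Defs
  imports
    "HOL-Computational_Algebra.Polynomial"
    "HOL-Probability.Probability"
    "HOL-Library.Poly_Mapping"
begin

text \<open>All index sets \<open>{1,...,a}\<close> of the mathematical text are rendered as \<open>{0,...,a-1}\<close>.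
  The field with \<open>q\<close> elements is the type variable, so \<open>q\<close> is its cardinality.\<close>


section \<open>Reed-Solomon codes and systematic Lagrange encoding\<close>

definition rs_code :: "(nat \<Rightarrow> 'a::field) \<Rightarrow> nat \<Rightarrow> nat \<Rightarrow> 'a list set" where
  "rs_code \<alpha> n k = {map (\<lambda>j. poly p (\<alpha> j)) [0..<n] |p. Polynomial.degree p < k}"

definition lagrange_poly :: "(nat \<Rightarrow> 'a::field) \<Rightarrow> nat \<Rightarrow> (nat \<Rightarrow> 'a) \<Rightarrow> 'a poly" where
  "lagrange_poly \<alpha> k w =
     (THE p. Polynomial.degree p \<le> k - 1 \<and> (\<forall>i<k. poly p (\<alpha> i) = w i))"

definition code_symbol :: "(nat \<Rightarrow> 'a::field) \<Rightarrow> nat \<Rightarrow> (nat \<Rightarrow> 'a) \<Rightarrow> nat \<Rightarrow> 'a" where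
  "code_symbol \<alpha> k w j = poly (lagrange_poly \<alpha> k w) (\<alpha> j)"

definition encode :: "(nat \<Rightarrow> 'a::field) \<Rightarrow> nat \<Rightarrow> nat \<Rightarrow> (nat \<Rightarrow> 'a) \<Rightarrow> 'a list" where
  "encode \<alpha> n k w = map (code_symbol \<alpha> k w) [0..<n]"

lemma lagrange_unique:
  fixes p p' :: "'a::field poly"
  assumes "1 \<le> k" "inj_on \<alpha> {..<k}"
    and "Polynomial.degree p \<le> k - 1" "\<forall>i<k. poly p (\<alpha> i) = w i"
    and "Polynomial.degree p' \<le> k - 1" "\<forall>i<k. poly p' (\<alpha> i) = w i"
  shows "p = p'"
proof (rule poly_eqI_degree[where A = "\<alpha> ` {..<k}"])
  have "card (\<alpha> ` {..<k}) = k"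
    using assms(2) by (simp add: card_image)
  then show "Polynomial.degree p < card (\<alpha> ` {..<k})"
    and "Polynomial.degree p' < card (\<alpha> ` {..<k})"
    using assms by auto
qed (use assms in auto)

lemma lagrange_exists:
  fixes \<alpha> :: "nat \<Rightarrow> 'a::field"
  assumes "1 \<le> k" "inj_on \<alpha> {..<k}"
  shows "\<exists>p. Polynomial.degree p \<le> k - 1 \<and> (\<forall>i<k. poly p (\<alpha> i) = w i)"
  using assms
proof (induction k rule: dec_induct)
  case base
  have "Polynomial.degree [:w 0:] \<le> 1 - 1 \<and> (\<forall>i<1. poly [:w 0:] (\<alpha> i) = w i)"
    by simp
  then show ?case by blast
next
  case (step k)
  have "inj_on \<alpha> {..<k}"
    using step.prems by (rule inj_on_subset) auto
  then obtain p where p: "Polynomial.degree p \<le> k - 1" "\<forall>i<k. poly p (\<alpha> i) = w i"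
    using step.IH by blast
  define r where "r = (\<Prod>i<k. [:- \<alpha> i, 1:])"
  have r0: "poly r (\<alpha> i) = 0" if "i < k" for i
    using that by (auto simp: r_def poly_prod)
  have "\<alpha> k \<noteq> \<alpha> i" if "i < k" for i
    using inj_onD[OF step.prems, of k i] that by auto
  then have rk: "poly r (\<alpha> k) \<noteq> 0"
    by (auto simp: r_def poly_prod)
  have dr: "Polynomial.degree r \<le> k"
    unfolding r_def by (rule order.trans[OF degree_prod_sum_le]) auto
  define p' where "p' = p + Polynomial.smult ((w k - poly p (\<alpha> k)) / poly r (\<alpha> k)) r"
  have "Polynomial.degree p' \<le> Suc k - 1"
    unfolding p'_def
    using p(1) dr Polynomial.degree_smult_le[of "(w k - poly p (\<alpha> k)) / poly r (\<alpha> k)" r]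
    by (intro Polynomial.degree_add_le) auto
  moreover have "\<forall>i<Suc k. poly p' (\<alpha> i) = w i"
    using p(2) r0 rk by (auto simp: p'_def less_Suc_eq)
  ultimately show ?case by blast
qed

lemma lagrange_poly:
  fixes \<alpha> :: "nat \<Rightarrow> 'a::field"
  assumes "1 \<le> k" "inj_on \<alpha> {..<k}"
  shows "Polynomial.degree (lagrange_poly \<alpha> k w) \<le> k - 1"
    and "\<forall>i<k. poly (lagrange_poly \<alpha> k w) (\<alpha> i) = w i"
proof -
  have "\<exists>!p. Polynomial.degree p \<le> k - 1 \<and> (\<forall>i<k. poly p (\<alpha> i) = w i)"
    using lagrange_exists[OF assms] lagrange_unique[OF assms] by blast
  from theI'[OF this]
  show "Polynomial.degree (lagrange_poly \<alpha> k w) \<le> k - 1"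
    and "\<forall>i<k. poly (lagrange_poly \<alpha> k w) (\<alpha> i) = w i"
    by (simp_all add: lagrange_poly_def)
qed

lemma code_symbol_systematic:
  assumes "1 \<le> k" "inj_on \<alpha> {..<k}" "i < k"
  shows "code_symbol \<alpha> k w i = w i"
  using lagrange_poly(2)[OF assms(1,2)] assms(3) by (simp add: code_symbol_def)

lemma range_encode:
  assumes "1 \<le> k" "inj_on \<alpha> {..<k}"
  shows "range (encode \<alpha> n k) = rs_code \<alpha> n k"
proof (intro equalityI subsetI)
  fix x assume "x \<in> range (encode \<alpha> n k)"
  then obtain w where "x = encode \<alpha> n k w"
    by blast
  then have "x = map (\<lambda>j. poly (lagrange_poly \<alpha> k w) (\<alpha> j)) [0..<n]"
    by (simp add: encode_def code_symbol_def)
  moreover have "Polynomial.degree (lagrange_poly \<alpha> k w) < k"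
    using lagrange_poly(1)[OF assms, of w] assms(1) by linarith
  ultimately show "x \<in> rs_code \<alpha> n k"
    by (auto simp: rs_code_def)
next
  fix x assume "x \<in> rs_code \<alpha> n k"
  then obtain p where p: "Polynomial.degree p < k" "x = map (\<lambda>j. poly p (\<alpha> j)) [0..<n]"
    by (auto simp: rs_code_def)
  have "lagrange_poly \<alpha> k (\<lambda>i. poly p (\<alpha> i)) = p"
    by (rule lagrange_unique[OF assms lagrange_poly[OF assms]]) (use p in auto)
  then have "x = encode \<alpha> n k (\<lambda>i. poly p (\<alpha> i))"
    by (simp add: p encode_def code_symbol_def)
  then show "x \<in> range (encode \<alpha> n k)" by blast
qed


section \<open>Candidate polynomials\<close>

text \<open>Formal multivariate polynomials: a monomial maps each variable index to its exponent, a
  polynomial maps each monomial to its coefficient. They are not identified with the functions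
  they induce, which matters when the degree bound reaches \<open>q\<close>.\<close>

type_synonym 'a mvpoly = "(nat \<Rightarrow>\<^sub>0 nat) \<Rightarrow>\<^sub>0 'a"

definition monom_degree :: "(nat \<Rightarrow>\<^sub>0 nat) \<Rightarrow> nat" where
  "monom_degree m = (\<Sum>i\<in>Poly_Mapping.keys m. Poly_Mapping.lookup m i)"

definition mv_eval :: "'a::comm_ring_1 mvpoly \<Rightarrow> (nat \<Rightarrow> 'a) \<Rightarrow> 'a" where
  "mv_eval p x = (\<Sum>m\<in>Poly_Mapping.keys p. Poly_Mapping.lookup p m *
     (\<Prod>i\<in>Poly_Mapping.keys m. x i ^ Poly_Mapping.lookup m i))"

definition mv_var :: "nat \<Rightarrow> 'a::comm_ring_1 mvpoly" where
  "mv_var i = Poly_Mapping.single (Poly_Mapping.single i 1) 1"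

definition candidate_set :: "nat \<Rightarrow> nat \<Rightarrow> nat \<Rightarrow> (nat \<Rightarrow> 'a::field mvpoly) \<Rightarrow> bool" where
  "candidate_set g f \<mu> \<phi> \<longleftrightarrow>
     (\<forall>v<\<mu>. \<forall>m\<in>Poly_Mapping.keys (\<phi> v).
        Poly_Mapping.keys m \<subseteq> {..<f} \<and> 1 \<le> monom_degree m \<and> monom_degree m \<le> g) \<and>
     (\<forall>v<\<mu>. \<phi> v \<noteq> 0) \<and>
     (\<forall>v<\<mu>. \<forall>v'<\<mu>. v \<noteq> v' \<longrightarrow>
        \<not> (\<exists>c. \<forall>m. Poly_Mapping.lookup (\<phi> v') m = c * Poly_Mapping.lookup (\<phi> v) m)) \<and>
     (\<forall>i<f. \<exists>v<\<mu>. \<phi> v = mv_var i)"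

definition num_monoms :: "nat \<Rightarrow> nat \<Rightarrow> nat" where
  "num_monoms g f = (g + f choose g) - 1"

definition num_polys :: "nat \<Rightarrow> nat \<Rightarrow> nat \<Rightarrow> nat" where
  "num_polys q g f = (q ^ num_monoms g f - 1) div (q - 1)"


section \<open>Messages, storage and candidate evaluations\<close>

text \<open>The entry in row \<open>i\<close> and column \<open>c\<close> of message \<open>m\<close> is \<open>W (m, i, c)\<close>. All entries are
  independent and uniform; outside the index range \<open>W\<close> is constantly 0.\<close>

definition messages :: "nat \<Rightarrow> nat \<Rightarrow> nat \<Rightarrow> (nat \<times> nat \<times> nat \<Rightarrow> 'a::{field,finite}) pmf" where
  "messages f \<beta> k = Pi_pmf ({..<f} \<times> {..<\<beta>} \<times> {..<k}) 0 (\<lambda>_. pmf_of_set UNIV)"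

text \<open>A message matrix read as a vector of length \<open>\<beta> * k\<close>, row by row.\<close>

definition message_symbol :: "nat \<Rightarrow> (nat \<times> nat \<times> nat \<Rightarrow> 'a) \<Rightarrow> nat \<Rightarrow> nat \<Rightarrow> 'a" where
  "message_symbol k W m l = W (m, l div k, l mod k)"

text \<open>The content of database \<open>j\<close>: entry \<open>m\<close> of row \<open>i\<close> is the \<open>j\<close>-th code symbol of the
  \<open>i\<close>-th row of message \<open>m\<close>.\<close>

definition stored ::
  "(nat \<Rightarrow> 'a::field) \<Rightarrow> nat \<Rightarrow> nat \<Rightarrow> nat \<Rightarrow> (nat \<times> nat \<times> nat \<Rightarrow> 'a) \<Rightarrow> nat \<Rightarrow> 'a list list" where
  "stored \<alpha> k f \<beta> W j =
     map (\<lambda>i. map (\<lambda>m. code_symbol \<alpha> k (\<lambda>c. W (m, i, c)) j) [0..<f]) [0..<\<beta>]"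

definition cand_value ::
  "nat \<Rightarrow> (nat \<Rightarrow> 'a::field mvpoly) \<Rightarrow> (nat \<times> nat \<times> nat \<Rightarrow> 'a) \<Rightarrow> nat \<Rightarrow> nat \<Rightarrow> 'a" where
  "cand_value k \<phi> W v l = mv_eval (\<phi> v) (\<lambda>m. message_symbol k W m l)"

definition cand_vec ::
  "nat \<Rightarrow> nat \<Rightarrow> (nat \<Rightarrow> 'a::field mvpoly) \<Rightarrow> (nat \<times> nat \<times> nat \<Rightarrow> 'a) \<Rightarrow> nat \<Rightarrow> 'a list" where
  "cand_vec \<beta> k \<phi> W v = map (cand_value k \<phi> W v) [0..<\<beta> * k]"

definition cand_all ::
  "nat \<Rightarrow> nat \<Rightarrow> nat \<Rightarrow> (nat \<Rightarrow> 'a::field mvpoly) \<Rightarrow> (nat \<times> nat \<times> nat \<Rightarrow> 'a) \<Rightarrow> 'a list list" where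
  "cand_all \<beta> k \<mu> \<phi> W = map (cand_vec \<beta> k \<phi> W) [0..<\<mu>]"

text \<open>The \<open>q\<close>-ary entropy of a candidate at one position, where the \<open>f\<close> message symbols are
  independent and uniform. By \<open>entropy_cand_value\<close> below this is the entropy of every single
  coordinate of the candidate evaluation, whatever \<open>\<beta>\<close> and \<open>k\<close> are.\<close>

definition cand_entropy :: "nat \<Rightarrow> 'a::{field,finite} mvpoly \<Rightarrow> real" where
  "cand_entropy f p = prob_space.entropy (measure_pmf (Pi_pmf {..<f} 0 (\<lambda>_. pmf_of_set UNIV)))
     (real CARD('a)) (count_space UNIV) (mv_eval p)"

definition H_min :: "nat \<Rightarrow> nat \<Rightarrow> (nat \<Rightarrow> 'a::{field,finite} mvpoly) \<Rightarrow> real" where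
  "H_min f \<mu> \<phi> = Min ((\<lambda>v. cand_entropy f (\<phi> v)) ` {..<\<mu>})"

lemma message_symbol_pmf:
  assumes "l < \<beta> * k"
  shows "map_pmf (\<lambda>W m. message_symbol k W m l) (messages f \<beta> k) =
         Pi_pmf {..<f} (0 :: 'a::{field,finite}) (\<lambda>_. pmf_of_set UNIV)"
proof -
  have k: "0 < k" using assms by (cases k) auto
  have il: "l div k < \<beta>" "l mod k < k"
    using assms k by (simp_all add: less_mult_imp_div_less)
  let ?U = "\<lambda>_. pmf_of_set (UNIV :: 'a set)"
  let ?h = "\<lambda>m. (m, l div k, l mod k)"
  let ?A = "{..<f} \<times> {..<\<beta>} \<times> {..<k}"
  let ?B = "?h ` {..<f}"
  have bij: "bij_betw ?h {..<f} ?B"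
    by (auto simp: bij_betw_def inj_on_def)
  have sub: "?B \<subseteq> ?A" using il by auto
  have "Pi_pmf {..<f} 0 ?U = map_pmf (\<lambda>W m. if m \<in> {..<f} then W (?h m) else 0) (Pi_pmf ?A 0 ?U)"
  proof -
    have "Pi_pmf {..<f} 0 ?U = map_pmf (\<lambda>W. W \<circ> ?h) (Pi_pmf ?B 0 ?U)"
      by (rule Pi_pmf_bij_betw[OF _ bij]) auto
    also have "Pi_pmf ?B 0 ?U = map_pmf (\<lambda>W x. if x \<in> ?B then W x else 0) (Pi_pmf ?A 0 ?U)"
      by (rule Pi_pmf_subset[OF _ sub]) auto
    finally show ?thesis
      by (auto simp: pmf.map_comp o_def image_iff intro!: map_pmf_cong)
  qed
  also have "\<dots> = map_pmf (\<lambda>W m. message_symbol k W m l) (messages f \<beta> k)"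
    unfolding messages_def
  proof (rule map_pmf_cong[OF refl])
    fix W :: "nat \<times> nat \<times> nat \<Rightarrow> 'a"
    assume "W \<in> set_pmf (Pi_pmf ?A 0 ?U)"
    moreover have "set_pmf (Pi_pmf ?A 0 ?U) \<subseteq> {W. \<forall>x. x \<notin> ?A \<longrightarrow> W x = 0}"
      by (rule set_Pi_pmf_subset) simp
    ultimately have W0: "\<forall>x. x \<notin> ?A \<longrightarrow> W x = 0"
      by blast
    then show "(\<lambda>m. if m \<in> {..<f} then W (?h m) else 0) = (\<lambda>m. message_symbol k W m l)"
      using W0 by (intro ext) (simp add: message_symbol_def)
  qed
  finally show ?thesis by simp
qed

lemma entropy_cand_value:
  fixes \<phi> :: "nat \<Rightarrow> 'a::{field,finite} mvpoly"
  assumes "l < \<beta> * k"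
  shows "prob_space.entropy (measure_pmf (messages f \<beta> k)) (real CARD('a)) (count_space UNIV)
           (\<lambda>W. cand_value k \<phi> W v l) = cand_entropy f (\<phi> v)"
proof -
  have "map_pmf (\<lambda>W. cand_value k \<phi> W v l) (messages f \<beta> k) =
        map_pmf (mv_eval (\<phi> v)) (Pi_pmf {..<f} 0 (\<lambda>_. pmf_of_set UNIV))"
    unfolding message_symbol_pmf[OF assms, symmetric]
    by (simp add: pmf.map_comp o_def cand_value_def)
  then have "distr (measure_pmf (messages f \<beta> k)) (count_space UNIV) (\<lambda>W. cand_value k \<phi> W v l) =
        distr (measure_pmf (Pi_pmf {..<f} 0 (\<lambda>_. pmf_of_set UNIV))) (count_space UNIV) (mv_eval (\<phi> v))"
    by (simp flip: map_pmf_rep_eq)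
  then show ?thesis
    by (simp add: cand_entropy_def prob_space.entropy_def prob_space_measure_pmf)
qed


section \<open>Private polynomial computation protocols\<close>

text \<open>A protocol consists of the number \<open>\<beta>\<close> of rows per message, the joint law of the queries
  (one for each database) for each desired index, and the answer map of each database. Queries
  are strings over the field, of arbitrary length; the empty string is the empty query. The
  answer map does not take the desired index as an argument.\<close>

record 'a ppc_protocol =
  rows :: nat
  query_law :: "nat \<Rightarrow> (nat \<Rightarrow> 'a list) pmf"
  answer :: "nat \<Rightarrow> 'a list \<Rightarrow> 'a list list \<Rightarrow> 'a list"

abbreviation sample ::
  "nat \<Rightarrow> nat \<Rightarrow> 'a::{field,finite} ppc_protocol \<Rightarrow> nat \<Rightarrow>
     ((nat \<times> nat \<times> nat \<Rightarrow> 'a) \<times> (nat \<Rightarrow> 'a list)) pmf" where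
  "sample k f P v \<equiv> pair_pmf (messages f (rows P) k) (query_law P v)"

definition answer_of ::
  "(nat \<Rightarrow> 'a::field) \<Rightarrow> nat \<Rightarrow> nat \<Rightarrow> 'a ppc_protocol \<Rightarrow>
     (nat \<times> nat \<times> nat \<Rightarrow> 'a) \<times> (nat \<Rightarrow> 'a list) \<Rightarrow> nat \<Rightarrow> 'a list" where
  "answer_of \<alpha> k f P = (\<lambda>(W, Q) j. answer P j (Q j) (stored \<alpha> k f (rows P) W j))"

definition ppc_private ::
  "(nat \<Rightarrow> 'a::{field,finite}) \<Rightarrow> nat \<Rightarrow> nat \<Rightarrow> nat \<Rightarrow> nat \<Rightarrow> (nat \<Rightarrow> 'a mvpoly) \<Rightarrow>
     'a ppc_protocol \<Rightarrow> bool" where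
  "ppc_private \<alpha> n k f \<mu> \<phi> P \<longleftrightarrow>
     (\<forall>v<\<mu>. \<forall>v'<\<mu>. v \<noteq> v' \<longrightarrow> (\<forall>j<n.
        map_pmf (\<lambda>\<omega>. (snd \<omega> j, answer_of \<alpha> k f P \<omega> j, cand_all (rows P) k \<mu> \<phi> (fst \<omega>)))
          (sample k f P v) =
        map_pmf (\<lambda>\<omega>. (snd \<omega> j, answer_of \<alpha> k f P \<omega> j, cand_all (rows P) k \<mu> \<phi> (fst \<omega>)))
          (sample k f P v')))"

text \<open>All random variables below take values in countable types, so the counting measures
  are \<open>\<sigma>\<close>-finite and the library's entropies are the usual discrete ones.\<close>

definition ppc_recovery ::
  "(nat \<Rightarrow> 'a::{field,finite}) \<Rightarrow> nat \<Rightarrow> nat \<Rightarrow> nat \<Rightarrow> nat \<Rightarrow> (nat \<Rightarrow> 'a mvpoly) \<Rightarrow>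
     'a ppc_protocol \<Rightarrow> bool" where
  "ppc_recovery \<alpha> n k f \<mu> \<phi> P \<longleftrightarrow>
     (\<forall>v<\<mu>. prob_space.conditional_entropy (measure_pmf (sample k f P v)) (real CARD('a))
        (count_space UNIV) (count_space UNIV)
        (\<lambda>\<omega>. cand_vec (rows P) k \<phi> (fst \<omega>) v)
        (\<lambda>\<omega>. (map (answer_of \<alpha> k f P \<omega>) [0..<n], map (snd \<omega>) [0..<n])) = 0)"

definition is_ppc_protocol ::
  "(nat \<Rightarrow> 'a::{field,finite}) \<Rightarrow> nat \<Rightarrow> nat \<Rightarrow> nat \<Rightarrow> nat \<Rightarrow> (nat \<Rightarrow> 'a mvpoly) \<Rightarrow>
     'a ppc_protocol \<Rightarrow> bool" where
  "is_ppc_protocol \<alpha> n k f \<mu> \<phi> P \<longleftrightarrow>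
     1 \<le> rows P \<and>
     (\<forall>j<n. \<forall>C. answer P j [] C = []) \<and>
     ppc_private \<alpha> n k f \<mu> \<phi> P \<and>
     ppc_recovery \<alpha> n k f \<mu> \<phi> P"

text \<open>The total number of downloaded symbols is \<open>D\<close> in every realisation and for every desired
  index; in particular \<open>D\<close> is also the expected download.\<close>

definition ppc_download ::
  "(nat \<Rightarrow> 'a::{field,finite}) \<Rightarrow> nat \<Rightarrow> nat \<Rightarrow> nat \<Rightarrow> nat \<Rightarrow> 'a ppc_protocol \<Rightarrow> nat \<Rightarrow> bool" where
  "ppc_download \<alpha> n k f \<mu> P D \<longleftrightarrow>
     (\<forall>v<\<mu>. \<forall>\<omega>\<in>set_pmf (sample k f P v). (\<Sum>j<n. length (answer_of \<alpha> k f P \<omega> j)) = D)"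

definition ppc_achievable ::
  "(nat \<Rightarrow> 'a::{field,finite}) \<Rightarrow> nat \<Rightarrow> nat \<Rightarrow> nat \<Rightarrow> nat \<Rightarrow> (nat \<Rightarrow> 'a mvpoly) \<Rightarrow> real \<Rightarrow> bool" where
  "ppc_achievable \<alpha> n k f \<mu> \<phi> R \<longleftrightarrow>
     (\<exists>P D. is_ppc_protocol \<alpha> n k f \<mu> \<phi> P \<and> ppc_download \<alpha> n k f \<mu> P D \<and> 0 < D \<and>
        R = real (rows P * k) * H_min f \<mu> \<phi> / real D)"


section \<open>The asymptotic rate constant\<close>

definition k_tilde :: "nat \<Rightarrow> nat \<Rightarrow> nat \<Rightarrow> nat" where
  "k_tilde n k g = min (g * (k - 1) + 1) n"

text \<open>For \<open>1 \<le> k \<le> n\<close> the quotient \<open>n div k_tilde n k g\<close> is at least 1, and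
  \<open>k_tilde n k g = g * (k - 1) + 1\<close> outside the first case. Hence the final branch of each of the
  two definitions below is exactly the remaining case, with quotient at least 1 and remainder
  at least \<open>k\<close> (see \<open>rate_cases\<close>).\<close>

definition n_hat :: "nat \<Rightarrow> nat \<Rightarrow> nat \<Rightarrow> nat" where
  "n_hat n k g =
     (let kt = k_tilde n k g; m = n div kt in
      if m = 1 \<and> n - m * kt < k then n
      else if m > 1 \<and> n - m * kt < k then k + (m - 1) * kt
      else k + m * kt)"

definition rate_const :: "nat \<Rightarrow> nat \<Rightarrow> nat \<Rightarrow> real" where
  "rate_const n k g =
     (let kt = k_tilde n k g; m = n div kt; d = g * (k - 1) + 1 in
      if m = 1 \<and> n - m * kt < k
        then 1 / real n * max (real n - real (g * (k - 1)) - 1) 0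
      else if m > 1 \<and> n - (n div d) * d < k
        then 1 / real (n_hat n k g) * (real (n div d) * real k - real k)
      else 1 / real (n_hat n k g) * (real (n div d) * real k))"

lemma rate_cases:
  fixes n k g :: nat
  assumes "1 \<le> k" "k \<le> n"
  defines "kt \<equiv> k_tilde n k g" and "d \<equiv> g * (k - 1) + 1"
  shows "1 \<le> n div kt"
    and "\<not> (n div kt = 1 \<and> n - (n div kt) * kt < k) \<Longrightarrow> kt = d"
    and "\<not> (n div kt = 1 \<and> n - (n div kt) * kt < k) \<Longrightarrow>
         \<not> (n div kt > 1 \<and> n - (n div d) * d < k) \<Longrightarrow> n - (n div d) * d \<ge> k"
proof -
  have kt: "1 \<le> kt" "kt \<le> n"
    using assms by (auto simp: k_tilde_def)
  then show 1: "1 \<le> n div kt"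
    using div_le_mono[of kt n kt] by auto
  have 2: "kt = d" if "\<not> (n div kt = 1 \<and> n - (n div kt) * kt < k)"
  proof (rule ccontr)
    assume "kt \<noteq> d"
    then have "kt = n" by (auto simp: kt_def d_def k_tilde_def min_def split: if_splits)
    then show False using that assms(1,2) by auto
  qed
  then show "\<not> (n div kt = 1 \<and> n - (n div kt) * kt < k) \<Longrightarrow> kt = d" .
  show "n - (n div d) * d \<ge> k"
    if "\<not> (n div kt = 1 \<and> n - (n div kt) * kt < k)"
      "\<not> (n div kt > 1 \<and> n - (n div d) * d < k)"
    using that 1 2[OF that(1)] by fastforce
qed

end

theory Submission
  imports Defs
begin

text \<open>A candidate of degree at most \<open>g\<close>, evaluated at the stored code symbols of one row, is a
  polynomial of degree at most \<open>g * (k - 1)\<close> in the evaluation point, so any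
  \<open>d = g * (k - 1) + 1\<close> databases determine it. If all databases receive the same uniformly random
  linear query, \<open>d\<close> of them reveal the answers of all others. These others can therefore be asked
  for the desired candidate, hidden by the random query: \<open>d\<close> of them yield a whole row, and each
  systematic one yields an information symbol. If \<open>rate_const\<close> is not 0 it is attained exactly for
  every \<open>f\<close>; otherwise downloading all messages, at rate \<open>H_min / f\<close>, suffices.\<close>

section \<open>Vanishing conditional entropy\<close>

text \<open>Entropies are defined through Radon-Nikodym derivatives. A pmf is a density for counting
  measure, whose only null set is empty, so almost-everywhere uniqueness becomes uniqueness at every
  point.\<close>

lemma RN_deriv_count_space_pmf:
  fixes p :: "'x::countable pmf"
  shows "enn2real (RN_deriv (count_space UNIV) (measure_pmf p) x) = pmf p x"
proof -
  interpret sigma_finite_measure "count_space (UNIV :: 'x set)"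
    by (simp add: sigma_finite_measure_count_space_countable)
  have "AE y in count_space UNIV. ennreal (pmf p y) = RN_deriv (count_space UNIV) (measure_pmf p) y"
    by (rule RN_deriv_unique) (simp_all add: measure_pmf_eq_density)
  then have "ennreal (pmf p x) = RN_deriv (count_space UNIV) (measure_pmf p) x"
    by (simp add: AE_count_space)
  then show ?thesis
    by (metis enn2real_ennreal pmf_nonneg)
qed

text \<open>\<open>Y\<close> determines \<open>X\<close> on the support, so there the joint pmf
  equals the marginal pmf of \<open>Y\<close>, and the logarithm of their quotient is
  \<open>log b 1 = 0\<close>.\<close>

lemma conditional_entropy_eq_0:
  fixes p :: "'w pmf" and X :: "'w \<Rightarrow> 'x::countable" and Y :: "'w \<Rightarrow> 'y::countable"
  assumes "\<And>w w'. w \<in> set_pmf p \<Longrightarrow> w' \<in> set_pmf p \<Longrightarrow> Y w = Y w' \<Longrightarrow> X w = X w'"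
  shows "prob_space.conditional_entropy (measure_pmf p) b (count_space UNIV) (count_space UNIV) X Y = 0"
proof -
  have prod: "count_space (UNIV :: 'x set) \<Otimes>\<^sub>M count_space (UNIV :: 'y set) = count_space UNIV"
    by (subst pair_measure_countable) auto
  have dXY: "distr (measure_pmf p) (count_space UNIV) (\<lambda>w. (X w, Y w)) =
      measure_pmf (map_pmf (\<lambda>w. (X w, Y w)) p)"
    by (simp add: map_pmf_rep_eq)
  have dY: "distr (measure_pmf p) (count_space UNIV) Y = measure_pmf (map_pmf Y p)"
    by (simp add: map_pmf_rep_eq)
  have "pmf (map_pmf (\<lambda>w. (X w, Y w)) p) (X w, Y w) = pmf (map_pmf Y p) (Y w)"
    if "w \<in> set_pmf p" for w
    unfolding pmf_map
  proof (rule measure_pmf.finite_measure_eq_AE)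
    show "AE x in measure_pmf p. x \<in> (\<lambda>w. (X w, Y w)) -` {(X w, Y w)} \<longleftrightarrow> x \<in> Y -` {Y w}"
      unfolding AE_measure_pmf_iff using assms[OF _ that] by auto
  qed auto
  moreover have "pmf (map_pmf Y p) (Y w) \<noteq> 0" if "w \<in> set_pmf p" for w
    using that by (simp add: pmf_eq_0_set_pmf)
  ultimately have "AE z in measure_pmf (map_pmf (\<lambda>w. (X w, Y w)) p).
     (case z of (x, y) \<Rightarrow> log b (pmf (map_pmf (\<lambda>w. (X w, Y w)) p) (x, y) / pmf (map_pmf Y p) y)) = 0"
    by (auto simp: AE_measure_pmf_iff)
  then have "(\<integral>z. (case z of (x, y) \<Rightarrow>
      log b (pmf (map_pmf (\<lambda>w. (X w, Y w)) p) (x, y) / pmf (map_pmf Y p) y))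
      \<partial>measure_pmf (map_pmf (\<lambda>w. (X w, Y w)) p)) = 0"
    by (rule integral_eq_zero_AE)
  then show ?thesis
    unfolding prob_space.conditional_entropy_def[OF prob_space_measure_pmf] prod dXY dY
      RN_deriv_count_space_pmf by simp
qed


section \<open>Polynomials in the evaluation point\<close>

text \<open>Stored rows are lists of length \<open>f\<close>, on which \<open>(!)\<close> is
  unspecified from index \<open>f\<close> on; this discards such values.\<close>

lemma mv_eval_cong:
  assumes "\<And>m. m \<in> Poly_Mapping.keys p \<Longrightarrow> Poly_Mapping.keys m \<subseteq> V"
    and "\<And>i. i \<in> V \<Longrightarrow> x i = y i"
  shows "mv_eval p x = mv_eval p y"
  unfolding mv_eval_def
  by (intro sum.cong refl arg_cong2[where f = "(*)"] prod.cong arg_cong2[where f = "(^)"] assms(2))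
     (use assms(1) in auto)

text \<open>A formal composition rather than a function, so that it has a degree and interpolation
  applies.\<close>

definition mv_subst :: "'a::comm_ring_1 mvpoly \<Rightarrow> (nat \<Rightarrow> 'a poly) \<Rightarrow> 'a poly" where
  "mv_subst p h = (\<Sum>m\<in>Poly_Mapping.keys p. Polynomial.smult (Poly_Mapping.lookup p m)
     (\<Prod>i\<in>Poly_Mapping.keys m. h i ^ Poly_Mapping.lookup m i))"

lemma poly_mv_subst: "poly (mv_subst p h) z = mv_eval p (\<lambda>i. poly (h i) z)"
  by (simp add: mv_subst_def mv_eval_def poly_sum poly_prod)

lemma degree_mv_subst_le:
  assumes "\<And>m. m \<in> Poly_Mapping.keys p \<Longrightarrow> monom_degree m \<le> g"
    and "\<And>i. Polynomial.degree (h i) \<le> e"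
  shows "Polynomial.degree (mv_subst p h) \<le> g * e"
  unfolding mv_subst_def
proof (rule degree_sum_le)
  fix m assume m: "m \<in> Poly_Mapping.keys p"
  have "Polynomial.degree (\<Prod>i\<in>Poly_Mapping.keys m. h i ^ Poly_Mapping.lookup m i) \<le>
      (\<Sum>i\<in>Poly_Mapping.keys m. Polynomial.degree (h i ^ Poly_Mapping.lookup m i))"
    by (rule degree_prod_sum_le[unfolded o_def]) simp
  also have "\<dots> \<le> (\<Sum>i\<in>Poly_Mapping.keys m. Poly_Mapping.lookup m i * e)"
  proof (rule sum_mono)
    fix i
    have "Polynomial.degree (h i ^ Poly_Mapping.lookup m i) \<le>
        Polynomial.degree (h i) * Poly_Mapping.lookup m i"
      by (rule degree_power_le)
    also have "\<dots> \<le> e * Poly_Mapping.lookup m i"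
      using assms(2) by (rule mult_right_mono) simp
    finally show "Polynomial.degree (h i ^ Poly_Mapping.lookup m i) \<le> Poly_Mapping.lookup m i * e"
      by (simp add: mult.commute)
  qed
  also have "\<dots> = monom_degree m * e"
    by (simp add: monom_degree_def sum_distrib_right)
  also have "\<dots> \<le> g * e"
    using assms(1)[OF m] by (rule mult_right_mono) simp
  finally show "Polynomial.degree (Polynomial.smult (Poly_Mapping.lookup p m)
      (\<Prod>i\<in>Poly_Mapping.keys m. h i ^ Poly_Mapping.lookup m i)) \<le> g * e"
    using Polynomial.degree_smult_le order.trans by blast
qed simp

text \<open>Systematic encoding puts the information symbols at the first \<open>k\<close> nodes, so
  position \<open>l\<close> is the node of database \<open>l mod k\<close>.\<close>

lemma nth_cand_vec:
  assumes "1 \<le> k" "inj_on \<alpha> {..<k}" "l < \<beta> * k"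
  shows "cand_vec \<beta> k \<phi> W v ! l =
    poly (mv_subst (\<phi> v) (\<lambda>m. lagrange_poly \<alpha> k (\<lambda>c. W (m, l div k, c)))) (\<alpha> (l mod k))"
proof -
  have "l mod k < k" using assms(1) by simp
  then have "poly (lagrange_poly \<alpha> k (\<lambda>c. W (m, l div k, c))) (\<alpha> (l mod k)) = W (m, l div k, l mod k)"
    for m using lagrange_poly(2)[OF assms(1,2)] by blast
  then show ?thesis
    using assms(3) by (simp add: cand_vec_def cand_value_def message_symbol_def poly_mv_subst)
qed


section \<open>Query laws with fixed marginals\<close>

text \<open>The answer of a database is a function of its query and the messages, which are independent.\<close>

lemma ppc_privateI:
  assumes "\<And>v v' j. v < \<mu> \<Longrightarrow> v' < \<mu> \<Longrightarrow> j < n \<Longrightarrow>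
    map_pmf (\<lambda>Q. Q j) (query_law P v) = map_pmf (\<lambda>Q. Q j) (query_law P v')"
  shows "ppc_private \<alpha> n k f \<mu> \<phi> P"
  unfolding ppc_private_def
proof (intro allI impI)
  fix v v' j
  assume v: "v < \<mu>" "v' < \<mu>" and j: "j < n"
  let ?h = "\<lambda>(W, q). (q, answer P j q (stored \<alpha> k f (rows P) W j), cand_all (rows P) k \<mu> \<phi> W)"
  have "map_pmf (\<lambda>\<omega>. (snd \<omega> j, answer_of \<alpha> k f P \<omega> j, cand_all (rows P) k \<mu> \<phi> (fst \<omega>))) (sample k f P u) =
      map_pmf ?h (pair_pmf (messages f (rows P) k) (map_pmf (\<lambda>Q. Q j) (query_law P u)))" for u
    unfolding pair_map_pmf2 pmf.map_comp
    by (intro map_pmf_cong refl) (auto simp: answer_of_def apsnd_def)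
  then show "map_pmf (\<lambda>\<omega>. (snd \<omega> j, answer_of \<alpha> k f P \<omega> j, cand_all (rows P) k \<mu> \<phi> (fst \<omega>))) (sample k f P v) =
      map_pmf (\<lambda>\<omega>. (snd \<omega> j, answer_of \<alpha> k f P \<omega> j, cand_all (rows P) k \<mu> \<phi> (fst \<omega>))) (sample k f P v')"
    using assms[OF v j] by simp
qed

text \<open>Removes the entropy from recovery: only a deterministic uniqueness claim on the support
  of the queries remains.\<close>

lemma ppc_recoveryI:
  assumes "\<And>v W Q W' Q'. v < \<mu> \<Longrightarrow> Q \<in> set_pmf (query_law P v) \<Longrightarrow> Q' \<in> set_pmf (query_law P v) \<Longrightarrow>
    (\<And>j. j < n \<Longrightarrow> Q j = Q' j) \<Longrightarrow>
    (\<And>j. j < n \<Longrightarrow> answer_of \<alpha> k f P (W, Q) j = answer_of \<alpha> k f P (W', Q') j) \<Longrightarrow>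
    cand_vec (rows P) k \<phi> W v = cand_vec (rows P) k \<phi> W' v"
  shows "ppc_recovery \<alpha> n k f \<mu> \<phi> P"
  unfolding ppc_recovery_def
proof (intro allI impI, rule conditional_entropy_eq_0)
  fix v \<omega> \<omega>'
  assume v: "v < \<mu>" and \<omega>: "\<omega> \<in> set_pmf (sample k f P v)" "\<omega>' \<in> set_pmf (sample k f P v)"
    and eq: "(map (answer_of \<alpha> k f P \<omega>) [0..<n], map (snd \<omega>) [0..<n]) =
             (map (answer_of \<alpha> k f P \<omega>') [0..<n], map (snd \<omega>') [0..<n])"
  show "cand_vec (rows P) k \<phi> (fst \<omega>) v = cand_vec (rows P) k \<phi> (fst \<omega>') v"
    by (rule assms[OF v, of "snd \<omega>" "snd \<omega>'"]) (use \<omega> eq in auto)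
qed


section \<open>Shared side information\<close>

text \<open>There are \<open>s\<close> rounds, in which the first \<open>n'\<close> databases take part. In round \<open>t\<close> database
  \<open>j\<close> is asked for a random linear combination, common to all databases, of all candidates
  evaluated at all \<open>\<beta>\<close> stored rows; if \<open>row t j = Some i\<close>, the desired candidate at row \<open>i\<close> is
  added to it. The entry of a query that concerns round \<open>t\<close>, candidate \<open>u\<close> and row \<open>i\<close> is at
  position \<open>t * (\<mu> * \<beta>) + (u * \<beta> + i)\<close>.\<close>

locale side_info_scheme =
  fixes \<alpha> :: "nat \<Rightarrow> 'a::{field,finite}" and n k g f \<mu> :: nat and \<phi> :: "nat \<Rightarrow> 'a mvpoly"
    and s n' \<beta> :: nat and row :: "nat \<Rightarrow> nat \<Rightarrow> nat option"
  assumes k: "1 \<le> k" "k \<le> n" and inj: "inj_on \<alpha> {..<n}"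
    and keys: "\<And>v m. v < \<mu> \<Longrightarrow> m \<in> Poly_Mapping.keys (\<phi> v) \<Longrightarrow> Poly_Mapping.keys m \<subseteq> {..<f}"
    and deg: "\<And>v m. v < \<mu> \<Longrightarrow> m \<in> Poly_Mapping.keys (\<phi> v) \<Longrightarrow> monom_degree m \<le> g"
    and pos: "1 \<le> \<mu>" "1 \<le> s" "1 \<le> \<beta>" "1 \<le> n'" and n': "n' \<le> n"
    and row_less: "\<And>t j i. t < s \<Longrightarrow> j < n' \<Longrightarrow> row t j = Some i \<Longrightarrow> i < \<beta>"
    and side_info: "\<And>t. t < s \<Longrightarrow> g * (k - 1) < card {j. j < n' \<and> row t j = None}"
    and covered: "\<And>i c. i < \<beta> \<Longrightarrow> c < k \<Longrightarrow>
      \<exists>t<s. (c < n' \<and> row t c = Some i) \<or> g * (k - 1) < card {j. j < n' \<and> row t j = Some i}"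
begin

text \<open>In each round this is zero or, for \<open>v < \<mu>\<close>, the unit vector at the
  desired candidate and row; \<open>div\<close> and \<open>mod\<close> split a position into round
  and entry.\<close>

definition offset :: "nat \<Rightarrow> nat \<Rightarrow> nat \<Rightarrow> 'a" where
  "offset v j p = (case row (p div (\<mu> * \<beta>)) j of None \<Rightarrow> 0
     | Some i \<Rightarrow> of_bool (p mod (\<mu> * \<beta>) = v * \<beta> + i))"

definition queries :: "nat \<Rightarrow> 'a list \<Rightarrow> nat \<Rightarrow> 'a list" where
  "queries v r j = (if j < n' then map (\<lambda>p. r ! p + offset v j p) [0..<s * (\<mu> * \<beta>)] else [])"

definition response :: "'a list \<Rightarrow> 'a list list \<Rightarrow> nat \<Rightarrow> 'a" where
  "response x C t = (\<Sum>p<\<mu> * \<beta>. x ! (t * (\<mu> * \<beta>) + p) * mv_eval (\<phi> (p div \<beta>)) ((!) (C ! (p mod \<beta>))))"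

definition scheme :: "'a ppc_protocol" where
  "scheme = \<lparr>rows = \<beta>,
     query_law = (\<lambda>v. map_pmf (queries v) (pmf_of_set {r. length r = s * (\<mu> * \<beta>)})),
     answer = (\<lambda>j x C. if x = [] then [] else map (response x C) [0..<s])\<rparr>"

definition row_poly :: "(nat \<times> nat \<times> nat \<Rightarrow> 'a) \<Rightarrow> nat \<Rightarrow> nat \<Rightarrow> 'a poly" where
  "row_poly W u i = mv_subst (\<phi> u) (\<lambda>m. lagrange_poly \<alpha> k (\<lambda>c. W (m, i, c)))"

text \<open>A single polynomial serves all databases because the random list \<open>r\<close> is
  common to them.\<close>

definition side_poly :: "(nat \<times> nat \<times> nat \<Rightarrow> 'a) \<Rightarrow> 'a list \<Rightarrow> nat \<Rightarrow> 'a poly" where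
  "side_poly W r t = (\<Sum>p<\<mu> * \<beta>.
     Polynomial.smult (r ! (t * (\<mu> * \<beta>) + p)) (row_poly W (p div \<beta>) (p mod \<beta>)))"

lemma rows_scheme [simp]: "rows scheme = \<beta>"
  by (simp add: scheme_def)

lemma query_length_pos: "0 < s * (\<mu> * \<beta>)"
  using pos by simp

lemma inj_k: "inj_on \<alpha> {..<k}"
  using inj k(2) by (auto intro: inj_on_subset)

lemma finite_lists [simp]: "finite {r :: 'a list. length r = N}"
  using finite_lists_length_eq[of "UNIV :: 'a set" N] by simp

lemma lists_nonempty [simp]: "{r :: 'a list. length r = N} \<noteq> {}"
  by (simp add: Ex_list_of_length)

lemma degree_row_poly: "u < \<mu> \<Longrightarrow> Polynomial.degree (row_poly W u i) \<le> g * (k - 1)"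
  unfolding row_poly_def
  by (rule degree_mv_subst_le) (use deg lagrange_poly(1)[OF k(1) inj_k] in auto)

lemma degree_side_poly: "Polynomial.degree (side_poly W r t) \<le> g * (k - 1)"
  unfolding side_poly_def
proof (rule degree_sum_le)
  fix p assume "p \<in> {..<\<mu> * \<beta>}"
  then have "p div \<beta> < \<mu>" by (simp add: less_mult_imp_div_less)
  then show "Polynomial.degree (Polynomial.smult (r ! (t * (\<mu> * \<beta>) + p))
      (row_poly W (p div \<beta>) (p mod \<beta>))) \<le> g * (k - 1)"
    using degree_row_poly Polynomial.degree_smult_le order.trans by blast
qed simp

lemma mv_eval_stored:
  assumes "u < \<mu>" "i < \<beta>"
  shows "mv_eval (\<phi> u) ((!) (stored \<alpha> k f \<beta> W j ! i)) = poly (row_poly W u i) (\<alpha> j)"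
  unfolding row_poly_def poly_mv_subst
  by (rule mv_eval_cong[OF keys[OF assms(1)]])
     (use assms(2) in \<open>simp_all add: stored_def code_symbol_def\<close>)

lemma queries_nth:
  "j < n' \<Longrightarrow> p < s * (\<mu> * \<beta>) \<Longrightarrow> queries v r j ! p = r ! p + offset v j p"
  by (simp add: queries_def)

text \<open>Answers are linear in the query: the random part contributes the common polynomial, the
  unit vector in the offset the desired row.\<close>

lemma response_queries:
  assumes "j < n'" "t < s" "v < \<mu>"
  shows "response (queries v r j) (stored \<alpha> k f \<beta> W j) t = poly (side_poly W r t) (\<alpha> j) +
    (case row t j of None \<Rightarrow> 0 | Some i \<Rightarrow> poly (row_poly W v i) (\<alpha> j))"
proof -
  let ?K = "\<mu> * \<beta>" and ?e = "\<lambda>p. poly (row_poly W (p div \<beta>) (p mod \<beta>)) (\<alpha> j)"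
  have K: "0 < ?K" using pos by simp
  have idx: "t * ?K + p < s * ?K" if "p < ?K" for p
  proof -
    have "t * ?K + p < Suc t * ?K" using that by simp
    also have "\<dots> \<le> s * ?K" using assms(2) by (intro mult_right_mono) auto
    finally show ?thesis .
  qed
  have "response (queries v r j) (stored \<alpha> k f \<beta> W j) t =
      (\<Sum>p<?K. (r ! (t * ?K + p) + offset v j (t * ?K + p)) * ?e p)"
    unfolding response_def
  proof (rule sum.cong[OF refl])
    fix p assume "p \<in> {..<?K}"
    then have p: "p < ?K" by simp
    have "mv_eval (\<phi> (p div \<beta>)) ((!) (stored \<alpha> k f \<beta> W j ! (p mod \<beta>))) = ?e p"
      by (rule mv_eval_stored) (use p pos in \<open>auto simp: less_mult_imp_div_less\<close>)
    then show "queries v r j ! (t * ?K + p) * mv_eval (\<phi> (p div \<beta>)) ((!) (stored \<alpha> k f \<beta> W j ! (p mod \<beta>))) =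
        (r ! (t * ?K + p) + offset v j (t * ?K + p)) * ?e p"
      using queries_nth[OF assms(1) idx[OF p]] by simp
  qed
  also have "\<dots> = poly (side_poly W r t) (\<alpha> j) + (\<Sum>p<?K. offset v j (t * ?K + p) * ?e p)"
    by (simp add: side_poly_def poly_sum distrib_right sum.distrib)
  also have "(\<Sum>p<?K. offset v j (t * ?K + p) * ?e p) =
      (case row t j of None \<Rightarrow> 0 | Some i \<Rightarrow> poly (row_poly W v i) (\<alpha> j))"
  proof (cases "row t j")
    case None
    then show ?thesis using K by (auto simp: offset_def intro: sum.neutral)
  next
    case (Some i)
    have i: "i < \<beta>" using row_less[OF assms(2,1) Some] .
    have "v * \<beta> + i < Suc v * \<beta>" using i by simp
    also have "\<dots> \<le> ?K" using assms(3) by (intro mult_right_mono) auto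
    finally have vi: "v * \<beta> + i < ?K" .
    have "(\<Sum>p<?K. offset v j (t * ?K + p) * ?e p) = (\<Sum>p<?K. if p = v * \<beta> + i then ?e p else 0)"
      using K Some by (intro sum.cong refl) (simp add: offset_def)
    also have "\<dots> = ?e (v * \<beta> + i)" using vi by simp
    also have "\<dots> = poly (row_poly W v i) (\<alpha> j)" using i by simp
    finally show ?thesis using Some by simp
  qed
  finally show ?thesis .
qed

section \<open>Uniform query marginals and privacy\<close>

lemma queries_inj:
  assumes "length r = s * (\<mu> * \<beta>)" "length r' = s * (\<mu> * \<beta>)" "j < n'"
    and "queries v r j = queries v r' j"
  shows "r = r'"
proof (rule nth_equalityI)
  fix p assume "p < length r"
  then show "r ! p = r' ! p"
    using queries_nth[OF assms(3), of p v r] queries_nth[OF assms(3), of p v r'] assms by simp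
qed (use assms in simp)

text \<open>One-time pad: for fixed \<open>j\<close> the query is a translate of a uniform list, and
  translation permutes the lists of that length.\<close>

lemma marginal_query:
  assumes "j < n'"
  shows "map_pmf (\<lambda>Q. Q j) (query_law scheme v) = pmf_of_set {r. length r = s * (\<mu> * \<beta>)}"
proof -
  let ?A = "{r :: 'a list. length r = s * (\<mu> * \<beta>)}" and ?h = "\<lambda>r. queries v r j"
  have inj: "inj_on ?h ?A"
    using queries_inj[OF _ _ assms] by (auto simp: inj_on_def)
  have "?h ` ?A = ?A"
    by (rule endo_inj_surj[OF _ _ inj]) (use assms in \<open>auto simp: queries_def\<close>)
  then show ?thesis
    using map_pmf_of_set_inj[OF inj lists_nonempty finite_lists]
    by (simp add: scheme_def pmf.map_comp o_def)
qed

lemma answer_of_scheme: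
  assumes "j < n'"
  shows "answer_of \<alpha> k f scheme (W, queries v r) j =
    map (response (queries v r j) (stored \<alpha> k f \<beta> W j)) [0..<s]"
proof -
  have "queries v r j \<noteq> []"
    using assms query_length_pos by (simp add: queries_def)
  then show ?thesis
    by (simp add: answer_of_def scheme_def)
qed

lemma answer_of_scheme_unused:
  "\<not> j < n' \<Longrightarrow> answer_of \<alpha> k f scheme (W, queries v r) j = []"
  by (simp add: answer_of_def scheme_def queries_def)

lemma privacy: "ppc_private \<alpha> n k f \<mu> \<phi> scheme"
proof (rule ppc_privateI)
  fix v v' j
  show "map_pmf (\<lambda>Q. Q j) (query_law scheme v) = map_pmf (\<lambda>Q. Q j) (query_law scheme v')"
  proof (cases "j < n'")
    case True
    then show ?thesis by (simp add: marginal_query)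
  next
    case False
    then show ?thesis by (simp add: scheme_def pmf.map_comp o_def queries_def)
  qed
qed

section \<open>Interpolation and recovery\<close>

lemma poly_eq_on_databases:
  assumes "Polynomial.degree p \<le> g * (k - 1)" "Polynomial.degree p' \<le> g * (k - 1)"
    and "J \<subseteq> {..<n}" "g * (k - 1) < card J"
    and "\<And>j. j \<in> J \<Longrightarrow> poly p (\<alpha> j) = poly p' (\<alpha> j)"
  shows "p = p'"
proof (rule poly_eqI_degree[where A = "\<alpha> ` J"])
  have "card (\<alpha> ` J) = card J"
    using inj assms(3) by (intro card_image) (rule inj_on_subset)
  then show "Polynomial.degree p < card (\<alpha> ` J)" "Polynomial.degree p' < card (\<alpha> ` J)"
    using assms by auto
qed (use assms in auto)

text \<open>The databases with \<open>row t j = None\<close> determine the polynomial of the side information,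
  which is then cancelled from the answers of the others.\<close>

lemma desired_row_poly_eq:
  assumes "v < \<mu>" "t < s"
    and resp: "\<And>j. j < n' \<Longrightarrow> response (queries v r j) (stored \<alpha> k f \<beta> W j) t =
      response (queries v r j) (stored \<alpha> k f \<beta> W' j) t"
    and "j < n'" "row t j = Some i"
  shows "poly (row_poly W v i) (\<alpha> j) = poly (row_poly W' v i) (\<alpha> j)"
proof -
  have "side_poly W r t = side_poly W' r t"
  proof (rule poly_eq_on_databases[OF degree_side_poly degree_side_poly])
    show "{j. j < n' \<and> row t j = None} \<subseteq> {..<n}" using n' by auto
    fix j assume "j \<in> {j. j < n' \<and> row t j = None}"
    then show "poly (side_poly W r t) (\<alpha> j) = poly (side_poly W' r t) (\<alpha> j)"
      using resp[of j] assms(1,2) by (simp add: response_queries)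
  qed (rule side_info[OF assms(2)])
  then show ?thesis
    using resp[OF assms(4)] assms by (simp add: response_queries)
qed

lemma recovery: "ppc_recovery \<alpha> n k f \<mu> \<phi> scheme"
proof (rule ppc_recoveryI)
  fix v W Q W' Q'
  assume v: "v < \<mu>" and Q: "Q \<in> set_pmf (query_law scheme v)" "Q' \<in> set_pmf (query_law scheme v)"
    and QQ: "\<And>j. j < n \<Longrightarrow> Q j = Q' j"
    and A: "\<And>j. j < n \<Longrightarrow> answer_of \<alpha> k f scheme (W, Q) j = answer_of \<alpha> k f scheme (W', Q') j"
  from Q obtain r r' where r: "length r = s * (\<mu> * \<beta>)" "Q = queries v r"
    and r': "length r' = s * (\<mu> * \<beta>)" "Q' = queries v r'"
    by (auto simp: scheme_def set_pmf_of_set[OF lists_nonempty finite_lists])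
  \<comment> \<open>Database 0 always takes part, and its query alone reveals the random
    list.\<close>
  have "r = r'"
    by (rule queries_inj[OF r(1) r'(1), of 0 v]) (use QQ[of 0] r r' pos n' in auto)
  then have resp: "response (queries v r j) (stored \<alpha> k f \<beta> W j) t =
      response (queries v r j) (stored \<alpha> k f \<beta> W' j) t" if "j < n'" "t < s" for j t
    using A[of j] that n' by (simp add: r r' answer_of_scheme)
  show "cand_vec (rows scheme) k \<phi> W v = cand_vec (rows scheme) k \<phi> W' v"
    unfolding rows_scheme
  proof (rule nth_equalityI)
    fix l assume "l < length (cand_vec \<beta> k \<phi> W v)"
    then have l: "l < \<beta> * k" by (simp add: cand_vec_def)
    define i c where "i = l div k" and "c = l mod k"
    have i: "i < \<beta>" and c: "c < k"
      using l k by (auto simp: i_def c_def less_mult_imp_div_less)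
    obtain t where t: "t < s" and
      cov: "(c < n' \<and> row t c = Some i) \<or> g * (k - 1) < card {j. j < n' \<and> row t j = Some i}"
      using covered[OF i c] by blast
    note eq = desired_row_poly_eq[OF v t resp[OF _ t]]
    \<comment> \<open>Either database \<open>c\<close> itself was asked for row \<open>i\<close>, or
      enough databases were asked to interpolate the whole row polynomial.\<close>
    have "poly (row_poly W v i) (\<alpha> c) = poly (row_poly W' v i) (\<alpha> c)"
      using cov
    proof
      assume "c < n' \<and> row t c = Some i"
      then show ?thesis using eq by blast
    next
      assume "g * (k - 1) < card {j. j < n' \<and> row t j = Some i}"
      then have "row_poly W v i = row_poly W' v i"
        by (intro poly_eq_on_databases[OF degree_row_poly[OF v] degree_row_poly[OF v]])
           (use n' eq in auto)
      then show ?thesis by simp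
    qed
    then show "cand_vec \<beta> k \<phi> W v ! l = cand_vec \<beta> k \<phi> W' v ! l"
      unfolding nth_cand_vec[OF k(1) inj_k l] row_poly_def i_def c_def .
  qed (simp add: cand_vec_def)
qed

lemma download: "ppc_download \<alpha> n k f \<mu> scheme (s * n')"
  unfolding ppc_download_def
proof (intro allI impI ballI)
  fix v \<omega>
  assume "\<omega> \<in> set_pmf (sample k f scheme v)"
  then obtain W r where \<omega>: "\<omega> = (W, queries v r)"
    by (cases \<omega>) (auto simp: scheme_def)
  have "(\<Sum>j<n. length (answer_of \<alpha> k f scheme \<omega> j)) = (\<Sum>j<n. if j < n' then s else 0)"
    using \<omega> by (intro sum.cong refl) (simp add: answer_of_scheme answer_of_scheme_unused)
  also have "\<dots> = (\<Sum>j<n'. s)"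
    using n' by (intro sum.mono_neutral_cong_right) auto
  finally show "(\<Sum>j<n. length (answer_of \<alpha> k f scheme \<omega> j)) = s * n'"
    by simp
qed

lemma achievable:
  "ppc_achievable \<alpha> n k f \<mu> \<phi> (real (\<beta> * k) / real (s * n') * H_min f \<mu> \<phi>)"
  unfolding ppc_achievable_def
proof (intro exI conjI)
  show "is_ppc_protocol \<alpha> n k f \<mu> \<phi> scheme"
    using pos privacy recovery by (simp add: is_ppc_protocol_def) (simp add: scheme_def)
  show "ppc_download \<alpha> n k f \<mu> scheme (s * n')"
    by (rule download)
  show "0 < s * n'" using pos by simp
qed simp

end


section \<open>The three cases\<close>

text \<open>In round \<open>t\<close> the systematic databases are rotated by \<open>t\<close> places, so that \<open>k\<close> rounds recover
  every information symbol of \<open>n - d\<close> rows.\<close>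

lemma achievable_one_group:
  fixes \<alpha> :: "nat \<Rightarrow> 'a::{field,finite}"
  assumes "1 \<le> k" "k \<le> n" "inj_on \<alpha> {..<n}" "1 \<le> \<mu>"
    and "\<And>v m. v < \<mu> \<Longrightarrow> m \<in> Poly_Mapping.keys (\<phi> v) \<Longrightarrow> Poly_Mapping.keys m \<subseteq> {..<f}"
    and "\<And>v m. v < \<mu> \<Longrightarrow> m \<in> Poly_Mapping.keys (\<phi> v) \<Longrightarrow> monom_degree m \<le> g"
    and d: "d = g * (k - 1) + 1" "d < n" "n - d < k"
  shows "ppc_achievable \<alpha> n k f \<mu> \<phi> (real (n - d) / real n * H_min f \<mu> \<phi>)"
proof -
  \<comment> \<open>Since \<open>n - d < k\<close>, the rotation assigns \<open>n - d\<close>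
    systematic databases to distinct rows in each round; the other \<open>d\<close> databases supply
    side information.\<close>
  define row where "row t j = (if j < k \<and> (j + t) mod k < n - d then Some ((j + t) mod k) else None)"
    for t j :: nat
  interpret side_info_scheme \<alpha> n k g f \<mu> \<phi> k n "n - d" row
  proof (unfold_locales; (fact assms)?)
    fix t
    let ?S = "{j. j < n \<and> row t j \<noteq> None}" and ?N = "{j. j < n \<and> row t j = None}"
    have "inj_on (\<lambda>j. (j + t) mod k) {..<k}"
    proof (rule inj_onI)
      fix x y assume xy: "x \<in> {..<k}" "y \<in> {..<k}" "(x + t) mod k = (y + t) mod k"
      \<comment> \<open>Over the integers \<open>t\<close> can be subtracted under
        \<open>mod\<close>.\<close>
      then have "(int x + int t) mod int k = (int y + int t) mod int k"
        by (metis of_nat_add of_nat_mod)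
      then have "int x mod int k = int y mod int k"
        by (metis add_diff_cancel_right' mod_diff_left_eq)
      then show "x = y" using xy by simp
    qed
    then have "card ?S \<le> card {..<n - d}"
      by (intro card_inj_on_le[where f = "\<lambda>j. (j + t) mod k"])
         (auto simp: row_def intro: inj_on_subset split: if_splits)
    moreover have "card ?S + card ?N = card (?S \<union> ?N)"
      by (rule card_Un_disjoint[symmetric]) auto
    moreover have "?S \<union> ?N = {..<n}" by auto
    ultimately show "g * (k - 1) < card ?N" using d by simp
  next
    fix i c assume "i < n - d" "c < k"
    \<comment> \<open>The round sought is \<open>i - c\<close> modulo \<open>k\<close>; adding
      \<open>k - c\<close> avoids truncated subtraction.\<close>
    then have "(c + (i + (k - c)) mod k) mod k = i"
      using d by (simp add: mod_add_right_eq)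
    then have "row ((i + (k - c)) mod k) c = Some i"
      using \<open>i < n - d\<close> \<open>c < k\<close> by (simp add: row_def)
    then show "\<exists>t<k. (c < n \<and> row t c = Some i) \<or> g * (k - 1) < card {j. j < n \<and> row t j = Some i}"
      using \<open>c < k\<close> assms(2) by (intro exI[of _ "(i + (k - c)) mod k"]) auto
  qed (use assms in \<open>auto simp: row_def split: if_splits\<close>)
  show ?thesis using achievable assms(1) by simp
qed

text \<open>Besides the \<open>k\<close> systematic databases, which yield row 0, there are \<open>M\<close> groups of \<open>d\<close>
  databases: group 0 yields the side information and group \<open>b > 0\<close> yields row \<open>b\<close>.\<close>

lemma achievable_groups:
  fixes \<alpha> :: "nat \<Rightarrow> 'a::{field,finite}"
  assumes "1 \<le> k" "k \<le> n" "inj_on \<alpha> {..<n}" "1 \<le> \<mu>"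
    and "\<And>v m. v < \<mu> \<Longrightarrow> m \<in> Poly_Mapping.keys (\<phi> v) \<Longrightarrow> Poly_Mapping.keys m \<subseteq> {..<f}"
    and "\<And>v m. v < \<mu> \<Longrightarrow> m \<in> Poly_Mapping.keys (\<phi> v) \<Longrightarrow> monom_degree m \<le> g"
    and d: "d = g * (k - 1) + 1" and M: "1 \<le> M" "k + M * d \<le> n"
  shows "ppc_achievable \<alpha> n k f \<mu> \<phi> (real (M * k) / real (k + M * d) * H_min f \<mu> \<phi>)"
proof -
  \<comment> \<open>Group 0 carries no row, which leaves index 0 for the systematic databases and
    makes the rows exactly those below \<open>M\<close>.\<close>
  define row where "row t j = (if j < k then Some 0 else if j - k < d then None else Some ((j - k) div d))"
    for t j :: nat
  have group: "{k + b * d..<k + b * d + d} \<subseteq> {j. j < k + M * d}" if "b < M" for b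
  proof -
    have "Suc b * d \<le> M * d" using that by (intro mult_right_mono) auto
    then show ?thesis by auto
  qed
  interpret side_info_scheme \<alpha> n k g f \<mu> \<phi> 1 "k + M * d" M row
  proof (unfold_locales; (fact assms)?)
    fix t j i assume "j < k + M * d" "row t j = Some i"
    then show "i < M"
      using M by (auto simp: row_def less_mult_imp_div_less split: if_splits)
  next
    fix t
    have "{k..<k + d} \<subseteq> {j. j < k + M * d \<and> row t j = None}"
      using group[of 0] M by (auto simp: row_def)
    from card_mono[OF _ this] show "g * (k - 1) < card {j. j < k + M * d \<and> row t j = None}"
      using d by simp
  next
    fix i c assume i: "i < M" and c: "c < k"
    show "\<exists>t<1. (c < k + M * d \<and> row t c = Some i) \<or>
        g * (k - 1) < card {j. j < k + M * d \<and> row t j = Some i}"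
    proof (cases "i = 0")
      case True
      then show ?thesis using c by (simp add: row_def)
    next
      case False
      have "(j - k) div d = i" "d \<le> j - k" if "j \<in> {k + i * d..<k + i * d + d}" for j
      proof -
        have *: "i * d \<le> j - k" "j - k < i * d + d" using that by auto
        show "(j - k) div d = i"
          by (rule div_nat_eqI) (use * in \<open>simp_all add: mult.commute\<close>)
        have "1 * d \<le> i * d" using False by (intro mult_right_mono) auto
        then show "d \<le> j - k" using *(1) by linarith
      qed
      then have "{k + i * d..<k + i * d + d} \<subseteq> {j. j < k + M * d \<and> row 0 j = Some i}"
        using group[OF i] by (fastforce simp: row_def)
      from card_mono[OF _ this] have "g * (k - 1) < card {j. j < k + M * d \<and> row 0 j = Some i}"
        using d by simp
      then show ?thesis by simp
    qed
  qed (use assms in auto)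
  show ?thesis using achievable by simp
qed

text \<open>The \<open>k\<close> systematic databases send all messages in clear. Privacy holds
  because the queries ignore the desired index.\<close>

lemma achievable_download_all:
  fixes \<alpha> :: "nat \<Rightarrow> 'a::{field,finite}"
  assumes "1 \<le> k" "k \<le> n" "inj_on \<alpha> {..<n}" "1 \<le> f"
    and keys: "\<And>v m. v < \<mu> \<Longrightarrow> m \<in> Poly_Mapping.keys (\<phi> v) \<Longrightarrow> Poly_Mapping.keys m \<subseteq> {..<f}"
  shows "ppc_achievable \<alpha> n k f \<mu> \<phi> (1 / real f * H_min f \<mu> \<phi>)"
proof -
  define P :: "'a ppc_protocol" where "P = \<lparr>rows = 1,
    query_law = (\<lambda>v. return_pmf (\<lambda>j. if j < k then [1] else [])),
    answer = (\<lambda>j x C. if x = [] then [] else C ! 0)\<rparr>"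
  have [simp]: "rows P = 1" by (simp add: P_def)
  have inj_k: "inj_on \<alpha> {..<k}" using assms(2,3) by (auto intro: inj_on_subset)
  have ans: "answer_of \<alpha> k f P (W, Q) j = (if j < k then map (\<lambda>m. W (m, 0, j)) [0..<f] else [])"
    if "Q \<in> set_pmf (query_law P v)" for W Q v j
    using that code_symbol_systematic[OF assms(1) inj_k, of j]
    by (auto simp: P_def answer_of_def stored_def)
  have "ppc_private \<alpha> n k f \<mu> \<phi> P"
    by (rule ppc_privateI) (simp add: P_def)
  moreover have "ppc_recovery \<alpha> n k f \<mu> \<phi> P"
  proof (rule ppc_recoveryI)
    fix v W Q W' Q'
    assume v: "v < \<mu>" and Q: "Q \<in> set_pmf (query_law P v)" "Q' \<in> set_pmf (query_law P v)"
      and A: "\<And>j. j < n \<Longrightarrow> answer_of \<alpha> k f P (W, Q) j = answer_of \<alpha> k f P (W', Q') j"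
    have "W (m, 0, j) = W' (m, 0, j)" if "j < k" "m < f" for m j
      using A[of j] that assms(2) by (simp add: ans[OF Q(1)] ans[OF Q(2)])
    then show "cand_vec (rows P) k \<phi> W v = cand_vec (rows P) k \<phi> W' v"
      by (auto simp: cand_vec_def cand_value_def message_symbol_def intro!: mv_eval_cong[OF keys[OF v]])
  qed
  ultimately have "is_ppc_protocol \<alpha> n k f \<mu> \<phi> P"
    by (simp add: is_ppc_protocol_def) (simp add: P_def)
  moreover have "ppc_download \<alpha> n k f \<mu> P (k * f)"
    unfolding ppc_download_def
  proof (intro allI impI ballI)
    fix v \<omega>
    assume "\<omega> \<in> set_pmf (sample k f P v)"
    then obtain W Q where \<omega>: "\<omega> = (W, Q)" "Q \<in> set_pmf (query_law P v)"
      by (cases \<omega>) auto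
    have "(\<Sum>j<n. length (answer_of \<alpha> k f P \<omega> j)) = (\<Sum>j<n. if j < k then f else 0)"
      using \<omega> by (intro sum.cong refl) (simp add: ans)
    also have "\<dots> = (\<Sum>j<k. f)"
      using assms(2) by (intro sum.mono_neutral_cong_right) auto
    finally show "(\<Sum>j<n. length (answer_of \<alpha> k f P \<omega> j)) = k * f"
      by simp
  qed
  ultimately show ?thesis
    unfolding ppc_achievable_def using assms(1,4)
    by (intro exI[of _ P] exI[of _ "k * f"]) (simp add: divide_simps)
qed

text \<open>Outside the first case there are \<open>m = n div d\<close> groups of size
  \<open>d\<close>. If at least \<open>k\<close> databases are left over, they act as the systematic
  ones and \<open>M = m\<close>; otherwise one group makes room for these and
  \<open>M = m - 1\<close>.\<close>

lemma achievable_rate_const: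
  fixes \<alpha> :: "nat \<Rightarrow> 'a::{field,finite}"
  assumes "1 \<le> k" "k \<le> n" "inj_on \<alpha> {..<n}" "1 \<le> \<mu>" "1 \<le> g"
    and "\<And>v m. v < \<mu> \<Longrightarrow> m \<in> Poly_Mapping.keys (\<phi> v) \<Longrightarrow> Poly_Mapping.keys m \<subseteq> {..<f}"
    and "\<And>v m. v < \<mu> \<Longrightarrow> m \<in> Poly_Mapping.keys (\<phi> v) \<Longrightarrow> monom_degree m \<le> g"
    and c: "rate_const n k g \<noteq> 0"
  shows "ppc_achievable \<alpha> n k f \<mu> \<phi> (rate_const n k g * H_min f \<mu> \<phi>)"
proof -
  define d where "d = g * (k - 1) + 1"
  define kt where "kt = k_tilde n k g"
  define m where "m = n div kt"
  note cases = rate_cases[OF assms(1,2), of g, folded kt_def d_def, folded m_def]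
  have one_group: "ppc_achievable \<alpha> n k f \<mu> \<phi> (real (n - d) / real n * H_min f \<mu> \<phi>)"
    if "d < n" "n - d < k"
    by (rule achievable_one_group[OF assms(1-4) _ _ d_def that]) (use assms in blast)+
  have groups: "ppc_achievable \<alpha> n k f \<mu> \<phi> (real (M * k) / real (k + M * d) * H_min f \<mu> \<phi>)"
    if "1 \<le> M" "k + M * d \<le> n" for M
    by (rule achievable_groups[OF assms(1-4) _ _ d_def that]) (use assms in blast)+
  consider (one) "m = 1 \<and> n - m * kt < k"
    | (more) "kt = d" "m > 1" "n - m * d < k"
    | (rest) "kt = d" "\<not> (m = 1 \<and> n - m * d < k)" "\<not> (m > 1 \<and> n - m * d < k)" "k \<le> n - m * d"
    using cases by (metis m_def not_le)
  then show ?thesis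
  proof cases
    case one
    have "rate_const n k g = 1 / real n * max (real n - real (g * (k - 1)) - 1) 0"
      unfolding rate_const_def Let_def kt_def[symmetric] m_def[symmetric] if_P[OF one] ..
    also have "real n - real (g * (k - 1)) - 1 = real n - real d"
      by (simp add: d_def)
    finally have rc: "rate_const n k g = 1 / real n * max (real n - real d) 0" .
    \<comment> \<open>A nonzero constant forces the maximum to be positive, which also excludes
      truncation of \<open>kt\<close> at \<open>n\<close>.\<close>
    have "d < n"
    proof (rule ccontr)
      assume "\<not> d < n"
      then show False using c unfolding rc by simp
    qed
    moreover have "kt = d"
      using \<open>d < n\<close> by (simp add: kt_def k_tilde_def d_def)
    ultimately have "n - d < k" using one by (metis mult_1)
    then show ?thesis
      using one_group[OF \<open>d < n\<close>] \<open>d < n\<close> rc by (simp add: of_nat_diff)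
  next
    case more
    \<comment> \<open>One group of size \<open>d\<close> has room for the \<open>k\<close>
      systematic databases.\<close>
    have "k - 1 \<le> g * (k - 1)" using assms(5) by simp
    then have "k \<le> d" using assms(1) unfolding d_def by linarith
    then have "k + (m - 1) * d \<le> m * d"
      using more by (cases m) auto
    also have "\<dots> \<le> n" by (simp add: m_def more(1))
    finally have le: "k + (m - 1) * d \<le> n" .
    have md: "n div d = m" by (simp add: m_def more(1))
    have nh: "n_hat n k g = k + (m - 1) * d"
      using more(2-) unfolding n_hat_def Let_def kt_def[symmetric] more(1) md by simp
    have "rate_const n k g = 1 / real (n_hat n k g) * (real m * real k - real k)"
      using more(2-) unfolding rate_const_def Let_def kt_def[symmetric] d_def[symmetric] more(1) md
      by simp
    also have "\<dots> = real ((m - 1) * k) / real (k + (m - 1) * d)"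
      using more(2) unfolding nh by (simp add: of_nat_diff algebra_simps)
    finally show ?thesis
      using groups[OF _ le] more(2) by simp
  next
    case rest
    have "m * d \<le> n" by (simp add: m_def rest(1))
    then have le: "k + m * d \<le> n" using rest by linarith
    have md: "n div d = m" by (simp add: m_def rest(1))
    have nh: "n_hat n k g = k + m * d"
      using rest(2-) unfolding n_hat_def Let_def kt_def[symmetric] rest(1) md by simp
    have "rate_const n k g = 1 / real (n_hat n k g) * (real m * real k)"
      using rest(2-) unfolding rate_const_def Let_def kt_def[symmetric] d_def[symmetric] rest(1) md
      by simp
    then show ?thesis
      using groups[OF cases(1) le] unfolding nh by simp
  qed
qed

theorem corollary2:
  fixes \<alpha> :: "nat \<Rightarrow> 'a::{field,finite}"
    and n k g :: nat
    and \<mu> :: "nat \<Rightarrow> nat"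
    and \<phi> :: "nat \<Rightarrow> nat \<Rightarrow> 'a mvpoly"
  assumes "1 \<le> k" and "k \<le> n" and "n \<le> CARD('a)"
    and "inj_on \<alpha> {..<n}"
    and "1 \<le> g"
    and "\<And>f. 1 \<le> f \<Longrightarrow> f \<le> \<mu> f \<and> \<mu> f \<le> num_polys CARD('a) g f"
    and "\<And>f. 1 \<le> f \<Longrightarrow> candidate_set g f (\<mu> f) (\<phi> f)"
  shows "\<exists>\<epsilon> :: nat \<Rightarrow> real. \<epsilon> \<longlonglongrightarrow> 0 \<and>
    (\<forall>f\<ge>1. ppc_achievable \<alpha> n k f (\<mu> f) (\<phi> f)
      ((rate_const n k g + \<epsilon> f) * H_min f (\<mu> f) (\<phi> f)))"
proof -
  have keys: "Poly_Mapping.keys m \<subseteq> {..<f}" and deg: "monom_degree m \<le> g"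
    if "1 \<le> f" "v < \<mu> f" "m \<in> Poly_Mapping.keys (\<phi> f v)" for f v m
    using assms(7)[OF that(1)] that(2,3) by (auto simp: candidate_set_def)
  show ?thesis
  proof (cases "rate_const n k g = 0")
    case True
    \<comment> \<open>Every protocol has a positive factor in front of \<open>H_min\<close>, so a
      vanishing constant calls for a positive null sequence.\<close>
    have "(\<lambda>f. 1 / real f) \<longlonglongrightarrow> 0"
      by (rule lim_1_over_n)
    moreover have "ppc_achievable \<alpha> n k f (\<mu> f) (\<phi> f) (1 / real f * H_min f (\<mu> f) (\<phi> f))"
      if "1 \<le> f" for f
      by (rule achievable_download_all) (use assms that keys in auto)
    ultimately show ?thesis using True by auto
  next
    case False
    have "ppc_achievable \<alpha> n k f (\<mu> f) (\<phi> f) (rate_const n k g * H_min f (\<mu> f) (\<phi> f))"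
      if "1 \<le> f" for f
    proof (rule achievable_rate_const)
      show "1 \<le> \<mu> f" using assms(6)[OF that] that by linarith
    qed (use assms that keys deg False in auto)
    then show ?thesis by (intro exI[of _ "\<lambda>_. 0"]) simp
  qed
qed

end
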